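(* Let $n\ge 1$ be an integer. For all $p\in S_n$, $\mathfrak{F}^{-1}_{n+1}$ is defined at $\mathfrak{F}_n(p)$ and $\mathfrak{F}^{-1}_{n+1}(\mathfrak{F}_n(p))=p$.
   Context: $S_n$ is the group of permutations of $\{0,\dots,n-1\}$. The one-line representation of $p\in S_n$ is the sequence $p_0,\dots,p_{n-1}$ of images of $0,\dots,n-1$. The cycle notation $(a_0,\dots,a_n)$ denotes the permutation sending $a_i\mapsto a_{i+1}$ for $0\le i<n$ and $a_n\mapsto a_0$. Pseudo Foata Injection: $\mathfrak{F}_n:S_n\to S_{n+1}$ maps the permutation $p$ with one-line representation $p_0,\dots,p_{n-1}$ to the permutation of $\{0,\dots,n\}$ consisting of the single cycle $(p_0,\dots,p_{n-1},n)$. The partial function $\mathfrak{F}^{-1}_{n+1}:S_{n+1}\to S_n$ is defined exactly on the permutations $q\in S_{n+1}$ consisting of a single cycle of length $n+1$: write $q$ in cycle notation as $(q_0,\dots,q_{n-1},q_n)$, rotated so that $q_n=n$; then $\mathfrak{F}^{-1}_{n+1}(q)$ is the permutation in $S_n$ whose one-line representation is $q_0,\dots,q_{n-1}$. *)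

theory Defs
  imports "HOL-Combinatorics.Cycles"
begin

text \<open>
  \<open>S\<^sub>n\<close> is rendered as the set of functions \<open>p\<close> with \<open>p permutes {..<n}\<close>; these fix every
  natural number \<open>\<ge> n\<close>, so equality of permutations is equality of functions.
  The library's \<open>cycle_of_list [a\<^sub>0, \<dots>, a\<^sub>k]\<close> sends \<open>a\<^sub>i\<close> to \<open>a\<^bsub>i+1\<^esub>\<close> and \<open>a\<^sub>k\<close> to \<open>a\<^sub>0\<close>
  (see \<open>cyclic_rotation\<close>); \<open>cycle cs\<close> abbreviates \<open>distinct cs\<close>.
\<close>

definition one_line :: "nat \<Rightarrow> (nat \<Rightarrow> nat) \<Rightarrow> nat list" where
  "one_line n p = map p [0..<n]"

definition pseudo_foata :: "nat \<Rightarrow> (nat \<Rightarrow> nat) \<Rightarrow> (nat \<Rightarrow> nat)" where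
  "pseudo_foata n p = cycle_of_list (one_line n p @ [n])"

definition is_cycle_notation :: "nat \<Rightarrow> (nat \<Rightarrow> nat) \<Rightarrow> nat list \<Rightarrow> bool" where
  "is_cycle_notation m q cs \<longleftrightarrow> cycle cs \<and> set cs = {..<m} \<and> q = cycle_of_list cs"

definition is_full_cycle :: "nat \<Rightarrow> (nat \<Rightarrow> nat) \<Rightarrow> bool" where
  "is_full_cycle m q \<longleftrightarrow> q permutes {..<m} \<and> (\<exists>cs. is_cycle_notation m q cs)"

text \<open>
  The index \<open>m\<close> is that of the source \<open>S\<^sub>m\<close>; the target is \<open>S\<^bsub>m-1\<^esub>\<close>. The case \<open>m = 0\<close> is
  meaningless and excluded from the domain.
\<close>

definition pseudo_foata_inv :: "nat \<Rightarrow> (nat \<Rightarrow> nat) \<rightharpoonup> (nat \<Rightarrow> nat)" where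
  "pseudo_foata_inv m q =
    (if m \<ge> 1 \<and> is_full_cycle m q then
       let cs = (THE cs. is_cycle_notation m q cs \<and> last cs = m - 1)
       in Some (THE p. p permutes {..<m - 1} \<and> one_line (m - 1) p = butlast cs)
     else None)"

end

theory Submission
  imports Defs
begin

text \<open>The list \<open>one_line n p @ [n]\<close> is itself a cycle notation of
  \<open>pseudo_foata n p\<close>, already rotated so that \<open>n\<close> comes last. A full cycle
  has only one notation with a given last entry, since iterating the permutation from that entry
  reads off the list in order (\<open>cycle_of_list_funpow_last\<close>). So the inverse recovers
  this very list, and dropping \<open>n\<close> leaves the one-line form, which determines
  \<open>p\<close> (\<open>one_line_inject\<close>).\<close>

lemma cycle_of_list_funpow_last:
  assumes "cycle cs" "i < length cs"
  shows "(cycle_of_list cs ^^ Suc i) (last cs) = cs ! i"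
proof -
  have ne: "cs \<noteq> []" using assms(2) by auto
  have "(cycle_of_list cs ^^ Suc i) (last cs)
      = map (cycle_of_list cs ^^ Suc i) cs ! (length cs - 1)"
    using ne by (simp add: last_conv_nth del: funpow.simps)
  \<comment> \<open>A power of the cycle, mapped over its own list, rotates that list. The exponent
    is \<open>Suc i\<close> because the first step from the last entry wraps around to index
    0.\<close>
  also have "\<dots> = rotate (Suc i) cs ! (length cs - 1)"
    by (simp only: cyclic_rotation[OF assms(1)])
  also have "\<dots> = cs ! ((Suc i + (length cs - 1)) mod length cs)"
    using ne by (intro nth_rotate) simp
  also have "Suc i + (length cs - 1) = i + length cs"
    using assms(2) by simp
  finally show ?thesis
    using assms(2) by simp
qed

lemma cycle_of_list_inject_last:
  assumes "cycle cs" "cycle ds" "length cs = length ds" "last cs = last ds"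
    and "cycle_of_list cs = cycle_of_list ds"
  shows "cs = ds"
proof (rule nth_equalityI)
  fix i assume "i < length cs"
  then show "cs ! i = ds ! i"
    using cycle_of_list_funpow_last[of cs i] cycle_of_list_funpow_last[of ds i] assms by simp
qed fact

text \<open>Both lists are distinct with entry set \<open>{..<m}\<close>, hence have equal length.
  This is what makes the first \<open>THE\<close> in \<open>pseudo_foata_inv\<close> well
  determined.\<close>

lemma is_cycle_notation_unique:
  assumes "is_cycle_notation m q cs" "is_cycle_notation m q ds" "last cs = last ds"
  shows "cs = ds"
proof (rule cycle_of_list_inject_last)
  show "length cs = length ds"
    using assms(1,2) unfolding is_cycle_notation_def by (metis distinct_card)
  show "cycle_of_list cs = cycle_of_list ds"
    using assms(1,2) unfolding is_cycle_notation_def by metis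
qed (use assms is_cycle_notation_def in blast)+

lemma one_line_inject:
  assumes "p permutes {..<n}" "q permutes {..<n}" "one_line n p = one_line n q"
  shows "p = q"
proof
  fix x
  show "p x = q x"
    using assms by (cases "x < n") (auto simp: one_line_def permutes_not_in)
qed

lemma is_cycle_notation_pseudo_foata:
  assumes "p permutes {..<n}"
  shows "is_cycle_notation (Suc n) (pseudo_foata n p) (one_line n p @ [n])"
proof -
  have "set (one_line n p) = {..<n}"
    using permutes_image[OF assms] by (simp add: one_line_def atLeast0LessThan)
  moreover have "distinct (one_line n p)"
    using permutes_inj_on[OF assms] by (simp add: one_line_def distinct_map)
  ultimately show ?thesis
    by (simp add: is_cycle_notation_def pseudo_foata_def lessThan_Suc)
qed

lemma is_full_cycleI:
  assumes "is_cycle_notation m q cs"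
  shows "is_full_cycle m q"
  using assms cycle_permutes[of cs] unfolding is_full_cycle_def is_cycle_notation_def by metis

theorem proposition5:
  fixes n :: nat and p :: "nat \<Rightarrow> nat"
  assumes "n \<ge> 1" and "p permutes {..<n}"
  shows "pseudo_foata n p \<in> dom (pseudo_foata_inv (n + 1)) \<and>
         pseudo_foata_inv (n + 1) (pseudo_foata n p) = Some p"
proof -
  note cyc = is_cycle_notation_pseudo_foata[OF assms(2)]
  have "(THE cs. is_cycle_notation (Suc n) (pseudo_foata n p) cs \<and> last cs = n) = one_line n p @ [n]"
    using cyc by (intro the_equality) (auto intro: is_cycle_notation_unique)
  \<comment> \<open>The right-hand side \<open>one_line n p\<close> is the \<open>butlast\<close> of
    the list just recovered.\<close>
  moreover have "(THE p'. p' permutes {..<n} \<and> one_line n p' = one_line n p) = p"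
    using assms(2) by (intro the_equality) (auto intro: one_line_inject)
  ultimately have "pseudo_foata_inv (n + 1) (pseudo_foata n p) = Some p"
    using is_full_cycleI[OF cyc] by (simp add: pseudo_foata_inv_def)
  then show ?thesis by blast
qed

end
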